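(* Work over the semifield $\mathbb{R}_{\max,+}$ and let $n\geq1$. Let $\mathbf{C}\in\mathbb{R}_{\max,+}^{n\times n}$ be a column-regular matrix, $\mathbf{D}\in\mathbb{R}_{\max,+}^{n\times n}$ a matrix such that $\mathrm{Tr}(\mathbf{D}\mathbf{C})\leq\mathbb{1}$, and $\mathbf{g}\in\mathbb{R}_{\max,+}^{n}$ a vector. Consider the problem of minimizing $\mathbf{1}^{T}\mathbf{C}\mathbf{x}\mathbf{x}^{-}\mathbf{1}$ over all regular vectors $\mathbf{x}$ (i.e. $\mathbf{x}\in\mathbb{R}^{n}$) subject to $\mathbf{D}\mathbf{C}\mathbf{x}\oplus\mathbf{g}\leq\mathbf{x}$. Then the minimum value in this problem is equal to $$\theta=\mathbf{1}^{T}\mathbf{C}(\mathbf{D}\mathbf{C})^{\ast}\mathbf{1}=\|\mathbf{C}(\mathbf{D}\mathbf{C})^{\ast}\|,$$ and all regular solutions of the problem are given by $$\mathbf{x}=(\theta^{-1}\mathbf{1}\mathbf{1}^{T}\mathbf{C}\oplus\mathbf{D}\mathbf{C})^{\ast}\mathbf{u},\qquad \mathbf{u}\geq\mathbf{g};$$ that is, a regular vector $\mathbf{x}$ is a solution of the problem if and only if it has this form for some $\mathbf{u}\in\mathbb{R}_{\max,+}^{n}$ with $\mathbf{u}\geq\mathbf{g}$.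
   Context: $\mathbb{R}_{\max,+}=(\mathbb{R}\cup\{-\infty\},\max,+,-\infty,0)$ is the max-plus semifield: $\oplus=\max$, $\otimes=+$ (multiplication sign omitted), zero $\mathbb{0}=-\infty$, one $\mathbb{1}=0$, and $x^{-1}=-x$ for $x\in\mathbb{R}$; the order is the usual one. All matrix/vector operations follow the usual rules with these $\oplus,\otimes$; inequalities are componentwise. $\mathbf{1}=(0,\ldots,0)^{T}$ is the column vector of $n$ zeros; $\mathbf{I}$ is the identity matrix ($0$ on the diagonal, $-\infty$ elsewhere); $\mathbf{A}^{0}=\mathbf{I}$, $\mathbf{A}^{m}=\mathbf{A}^{m-1}\mathbf{A}$. For $\mathbf{A}=(a_{ij})$ of order $n$, $\mathrm{tr}\,\mathbf{A}=\bigoplus_{i=1}^{n}a_{ii}$ and $\mathrm{Tr}(\mathbf{A})=\bigoplus_{m=1}^{n}\mathrm{tr}\,\mathbf{A}^{m}$; if $\mathrm{Tr}(\mathbf{A})\leq\mathbb{1}$, the asterate (Kleene star) is $\mathbf{A}^{\ast}=\bigoplus_{m=0}^{n-1}\mathbf{A}^{m}$. A vector is regular if none of its entries is $-\infty$; a matrix is column-regular if it has no column consisting entirely of $-\infty$. For a regular column vector $\mathbf{x}$, $\mathbf{x}^{-}$ is the row vector with entries $-x_{i}$. $\|\mathbf{A}\|=\bigoplus_{i,j}a_{ij}$ is the maximum entry of $\mathbf{A}$. In ordinary notation, the objective is $\max_{i,j}(c_{ij}+x_{j})+\max_{k}(-x_{k})$. *)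

theory Defs
  imports "HOL-Analysis.Analysis"
begin

section \<open>The max-plus semifield\<close>

datatype maxplus = NegInf | Num real

text \<open>
  The semifield addition is the maximum and the semifield multiplication is the addition of reals, so
  \<open>0\<close> denotes minus infinity and \<open>1\<close> denotes the real number zero.  The sum over a
  finite set is then the maximum, and the library operations \<open>**\<close>, \<open>*v\<close>,
  \<open>mat\<close> and \<open>trace\<close> are the max-plus ones.
\<close>

instantiation maxplus :: linorder
begin

fun less_eq_maxplus :: "maxplus \<Rightarrow> maxplus \<Rightarrow> bool" where
  "NegInf \<le> y \<longleftrightarrow> True"
| "Num a \<le> NegInf \<longleftrightarrow> False"
| "Num a \<le> Num b \<longleftrightarrow> a \<le> b"

definition less_maxplus :: "maxplus \<Rightarrow> maxplus \<Rightarrow> bool" where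
  "x < y \<longleftrightarrow> x \<le> y \<and> \<not> y \<le> (x :: maxplus)"

instance
proof
  fix x y z :: maxplus
  show "x < y \<longleftrightarrow> x \<le> y \<and> \<not> y \<le> x" by (rule less_maxplus_def)
  show "x \<le> x" by (cases x) auto
  show "x \<le> y \<Longrightarrow> y \<le> z \<Longrightarrow> x \<le> z" by (cases x; cases y; cases z) auto
  show "x \<le> y \<Longrightarrow> y \<le> x \<Longrightarrow> x = y" by (cases x; cases y) auto
  show "x \<le> y \<or> y \<le> x" by (cases x; cases y) auto
qed

end

instantiation maxplus :: comm_semiring_1
begin

definition zero_maxplus :: maxplus where
  "0 = NegInf"

definition one_maxplus :: maxplus where
  "1 = Num 0"

definition plus_maxplus :: "maxplus \<Rightarrow> maxplus \<Rightarrow> maxplus" where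
  "x + y = max x (y :: maxplus)"

fun times_maxplus :: "maxplus \<Rightarrow> maxplus \<Rightarrow> maxplus" where
  "NegInf * y = NegInf"
| "Num a * NegInf = NegInf"
| "Num a * Num b = Num (a + b)"

instance
proof
  fix x y z :: maxplus
  show "x + y + z = x + (y + z)" by (simp add: plus_maxplus_def max.assoc)
  show "x + y = y + x" by (simp add: plus_maxplus_def max.commute)
  show "0 + x = x" by (cases x) (auto simp: plus_maxplus_def zero_maxplus_def max_def)
  show "x * y * z = x * (y * z)" by (cases x; cases y; cases z) auto
  show "x * y = y * x" by (cases x; cases y) auto
  show "1 * x = x" by (cases x) (auto simp: one_maxplus_def)
  show "0 * x = 0" by (auto simp: zero_maxplus_def)
  show "x * 0 = 0" by (cases x) (auto simp: zero_maxplus_def)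
  show "(x + y) * z = x * z + y * z"
    by (cases x; cases y; cases z) (auto simp: plus_maxplus_def max_def)
  show "(0 :: maxplus) \<noteq> 1" by (auto simp: zero_maxplus_def one_maxplus_def)
qed

end

text \<open>The value \<open>inverse 0 = 0\<close> is a totalisation and carries no meaning.\<close>

instantiation maxplus :: inverse
begin

fun inverse_maxplus :: "maxplus \<Rightarrow> maxplus" where
  "inverse NegInf = NegInf"
| "inverse (Num a) = Num (- a)"

definition divide_maxplus :: "maxplus \<Rightarrow> maxplus \<Rightarrow> maxplus" where
  "x div y = x * inverse (y :: maxplus)"

instance ..

end

lemma maxplus_right_inverse: "x \<noteq> 0 \<Longrightarrow> x * inverse x = (1 :: maxplus)"
  by (cases x) (auto simp: zero_maxplus_def one_maxplus_def)

section \<open>Matrices and vectors\<close>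

text \<open>
  On the type of vectors \<open>1\<close> is the vector all of whose entries are \<open>1\<close>;
  the identity matrix is \<open>mat 1\<close>, and the class power \<open>^\<close> is entrywise, whence
  \<open>mat_pow\<close>.
\<close>

abbreviation ones_col :: "maxplus ^ 1 ^ 'n" where
  "ones_col \<equiv> columnvector (1 :: maxplus ^ 'n)"

abbreviation ones_row :: "maxplus ^ 'n ^ 1" where
  "ones_row \<equiv> rowvector (1 :: maxplus ^ 'n)"

primrec mat_pow :: "maxplus ^ 'n ^ 'n \<Rightarrow> nat \<Rightarrow> maxplus ^ 'n ^ 'n" where
  "mat_pow A 0 = mat 1"
| "mat_pow A (Suc m) = mat_pow A m ** A"

definition scale_mat :: "maxplus \<Rightarrow> maxplus ^ 'n ^ 'm \<Rightarrow> maxplus ^ 'n ^ 'm" where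
  "scale_mat c A = (\<chi> i j. c * A $ i $ j)"

definition Tr :: "maxplus ^ 'n ^ 'n \<Rightarrow> maxplus" where
  "Tr A = (\<Sum>m = 1..CARD('n). trace (mat_pow A m))"

text \<open>
  The asterate is left unspecified unless \<open>Tr A \<le> 1\<close>.
\<close>

definition asterate :: "maxplus ^ 'n ^ 'n \<Rightarrow> maxplus ^ 'n ^ 'n" where
  "asterate A = (if Tr A \<le> 1 then (\<Sum>m = 0..CARD('n) - 1. mat_pow A m) else undefined)"

definition mat_norm :: "maxplus ^ 'n ^ 'm \<Rightarrow> maxplus" where
  "mat_norm A = (\<Sum>i\<in>UNIV. \<Sum>j\<in>UNIV. A $ i $ j)"

definition regular :: "maxplus ^ 'n \<Rightarrow> bool" where
  "regular x \<longleftrightarrow> (\<forall>i. x $ i \<noteq> 0)"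

definition column_regular :: "maxplus ^ 'n ^ 'm \<Rightarrow> bool" where
  "column_regular A \<longleftrightarrow> (\<forall>j. \<exists>i. A $ i $ j \<noteq> 0)"

text \<open>The conjugate row vector; it is meaningful for regular vectors only.\<close>

definition conj_row :: "maxplus ^ 'n \<Rightarrow> maxplus ^ 'n ^ 1" where
  "conj_row x = rowvector (\<chi> i. inverse (x $ i))"

section \<open>The optimization problem\<close>

text \<open>A one-by-one matrix is read as a scalar through its only entry \<open>$ 1 $ 1\<close>.\<close>

definition objective :: "maxplus ^ 'n ^ 'n \<Rightarrow> maxplus ^ 'n \<Rightarrow> maxplus" where
  "objective C x =
     (ones_row ** C ** (columnvector x :: maxplus ^ 1 ^ 'n) ** conj_row x ** ones_col) $ 1 $ 1"

definition feasible ::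
  "maxplus ^ 'n ^ 'n \<Rightarrow> maxplus ^ 'n ^ 'n \<Rightarrow> maxplus ^ 'n \<Rightarrow> maxplus ^ 'n \<Rightarrow> bool" where
  "feasible C D g x \<longleftrightarrow> regular x \<and> (D ** C) *v x + g \<le> x"

end

theory Submission
  imports Defs
begin

text \<open>
  Write \<open>B = D ** C\<close>, let \<open>y = asterate B *v 1\<close>, and let \<open>vec_max z\<close>
  be the largest entry of \<open>z\<close>, so that \<open>\<theta> = vec_max (C *v y)\<close>.

  The lower bound: a feasible \<open>x\<close> satisfies \<open>B *v x \<le> x\<close>, hence
  \<open>asterate B *v x \<le> x\<close>.  If \<open>\<mu>\<close> is the inverse of the least entry of
  \<open>x\<close>, then \<open>x\<close> lies above the constant vector \<open>inverse \<mu>\<close>, so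
  \<open>x\<close> lies above \<open>inverse \<mu> *s y\<close>.  Since the objective is
  \<open>vec_max (C *v x) * \<mu>\<close>, it is at least \<open>\<theta>\<close>
  (\<open>objective_lower_bound\<close>).

  The solutions: for regular \<open>x\<close>, the bound \<open>objective C x \<le> \<theta>\<close> says that
  \<open>vec_max (C *v x) * inverse (x $ k) \<le> \<theta>\<close> for every \<open>k\<close>, which is again a
  linear inequality of the form \<open>M *v x \<le> x\<close> (\<open>objective_le_iff\<close>); here
  \<open>\<theta> \<noteq> 0\<close> because \<open>C\<close> is column-regular.  Joined with the constraint it
  becomes \<open>A *v x \<le> x\<close>, \<open>g \<le> x\<close> for the matrix \<open>A\<close> of the theorem, and
  \<open>subfixed_above_iff_asterate\<close> solves this system, provided that \<open>Tr A \<le> 1\<close>.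

  Both this proviso and the attainment of \<open>\<theta>\<close> come from the vector \<open>y\<close> itself.  It
  is regular and satisfies \<open>A *v y \<le> y\<close>, and a matrix with such a subfixed vector has all
  its cycle weights at most \<open>1\<close> (\<open>Tr_le_one_if_subfixed\<close>).  A multiple of
  \<open>y\<close> by a large enough scalar satisfies the same inequality, lies above \<open>g\<close>, and is
  therefore a solution.

  The one combinatorial ingredient is the inequality \<open>A *v (asterate A *v u) \<le> asterate A *v u\<close>
  (\<open>asterate_subfixed\<close>), which rests on the removal of a cycle from a walk as long as the
  number of vertices (\<open>mat_pow_card_le_asterate\<close>).
\<close>

section \<open>Order structure of the max-plus semifield\<close>

instance maxplus :: ordered_comm_semiring
proof
  fix a b c :: maxplus
  show "a \<le> b \<Longrightarrow> c + a \<le> c + b"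
    by (auto simp: plus_maxplus_def max_def)
  show "a \<le> b \<Longrightarrow> 0 \<le> c \<Longrightarrow> c * a \<le> c * b"
    by (cases a; cases b; cases c) auto
qed

lemma maxplus_zero_le [simp]: "0 \<le> (a :: maxplus)"
  by (simp add: zero_maxplus_def)

lemma maxplus_le_zero_iff [simp]: "a \<le> 0 \<longleftrightarrow> a = (0 :: maxplus)"
  by (cases a) (auto simp: zero_maxplus_def)

lemma maxplus_mult_mono: "a \<le> b \<Longrightarrow> c \<le> d \<Longrightarrow> a * c \<le> b * (d :: maxplus)"
  by (simp add: mult_mono)

lemma maxplus_add_le_iff: "a + b \<le> c \<longleftrightarrow> a \<le> c \<and> b \<le> (c :: maxplus)"
  by (simp add: plus_maxplus_def)

lemma maxplus_sum_le_iff: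
  fixes f :: "'i \<Rightarrow> maxplus"
  assumes "finite S"
  shows "sum f S \<le> c \<longleftrightarrow> (\<forall>i\<in>S. f i \<le> c)"
  using assms by induction (simp_all add: maxplus_add_le_iff)

lemma maxplus_member_le_sum:
  fixes f :: "'i \<Rightarrow> maxplus"
  assumes "finite S" "i \<in> S"
  shows "f i \<le> sum f S"
  using maxplus_sum_le_iff[of S f "sum f S"] assms by simp

lemma maxplus_sum_attained:
  fixes f :: "'i \<Rightarrow> maxplus"
  assumes "finite S" "sum f S \<noteq> 0"
  obtains i where "i \<in> S" "sum f S = f i"
proof -
  have "sum f S \<noteq> 0 \<longrightarrow> (\<exists>i\<in>S. sum f S = f i)"
    using assms(1)
    by induction (auto simp: plus_maxplus_def max_def split: if_splits)
  then show thesis using assms(2) that by blast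
qed

lemma maxplus_inverse_mult_le_iff:
  "c \<noteq> 0 \<Longrightarrow> inverse c * a \<le> b \<longleftrightarrow> a \<le> c * (b :: maxplus)"
  by (cases a; cases b; cases c) (auto simp: zero_maxplus_def)

lemma maxplus_mult_inverse_le_iff:
  "c \<noteq> 0 \<Longrightarrow> a * inverse c \<le> b \<longleftrightarrow> a \<le> b * (c :: maxplus)"
  by (cases a; cases b; cases c) (auto simp: zero_maxplus_def)

lemma maxplus_mult_eq_zero_iff [simp]: "a * b = 0 \<longleftrightarrow> a = 0 \<or> b = (0 :: maxplus)"
  by (cases a; cases b) (auto simp: zero_maxplus_def)

text \<open>
Cancelling a nonzero factor is how a subfixed vector bounds the diagonal of a matrix power.
\<close>

lemma maxplus_mult_le_self_iff: "b \<noteq> 0 \<Longrightarrow> a * b \<le> b \<longleftrightarrow> a \<le> (1 :: maxplus)"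
  by (cases a; cases b) (auto simp: zero_maxplus_def one_maxplus_def)

section \<open>Subfixed vectors\<close>

lemma vec_add_le_iff: "x + y \<le> z \<longleftrightarrow> x \<le> z \<and> y \<le> (z :: maxplus ^ 'n)"
  by (auto simp: less_eq_vec_def maxplus_add_le_iff)

lemma matrix_vector_le_iff:
  fixes A :: "maxplus ^ 'n ^ 'm"
  shows "A *v x \<le> y \<longleftrightarrow> (\<forall>i j. A $ i $ j * x $ j \<le> y $ i)"
  by (simp add: less_eq_vec_def matrix_vector_mult_def maxplus_sum_le_iff)

lemma matrix_entry_le_matrix_matrix:
  fixes A :: "maxplus ^ 'k ^ 'm" and B :: "maxplus ^ 'n ^ 'k"
  shows "A $ i $ k * B $ k $ j \<le> (A ** B) $ i $ j"
  using maxplus_member_le_sum[of UNIV k "\<lambda>k. A $ i $ k * B $ k $ j"]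
  by (simp add: matrix_matrix_mult_def)

lemma matrix_vector_mono:
  fixes A B :: "maxplus ^ 'n ^ 'm"
  assumes "A \<le> B" "x \<le> y"
  shows "A *v x \<le> B *v y"
  using assms unfolding less_eq_vec_def matrix_vector_mult_def
  by (auto intro!: sum_mono maxplus_mult_mono)

lemma mat_pow_subfixed:
  fixes A :: "maxplus ^ 'n ^ 'n"
  assumes "A *v x \<le> x"
  shows "mat_pow A m *v x \<le> x"
proof (induction m)
  case (Suc m)
  have "mat_pow A (Suc m) *v x = mat_pow A m *v (A *v x)"
    by (simp add: matrix_vector_mul_assoc)
  also have "\<dots> \<le> mat_pow A m *v x"
    by (intro matrix_vector_mono order_refl assms)
  finally show ?case using Suc.IH by (rule order_trans)
qed simp

text \<open>
Every power of \<open>A\<close> also maps \<open>x\<close> below itself, so a diagonal entry \<open>d\<close> of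
that power satisfies \<open>d * x $ i \<le> x $ i\<close>; regularity allows \<open>x $ i\<close> to be
cancelled.  This yields the trace condition without an expansion of the powers of a sum of matrices.
\<close>

lemma Tr_le_one_if_subfixed:
  fixes A :: "maxplus ^ 'n ^ 'n"
  assumes "regular x" "A *v x \<le> x"
  shows "Tr A \<le> 1"
proof -
  have "mat_pow A m $ i $ i \<le> 1" for m i
    using mat_pow_subfixed[OF assms(2), of m] assms(1)
    unfolding matrix_vector_le_iff regular_def by (metis maxplus_mult_le_self_iff)
  then show ?thesis
    unfolding Tr_def trace_def by (simp add: maxplus_sum_le_iff)
qed

section \<open>The asterate\<close>

lemma mat_pow_add: "mat_pow A (m + k) = mat_pow A m ** mat_pow A k"
  by (induction k) (simp_all add: matrix_mul_assoc)

text \<open>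
The sequence \<open>f\<close> lists the vertices of a walk in the weighted digraph of \<open>A\<close>, and
only its part between the times \<open>a\<close> and \<open>b\<close> counts.  Keeping the whole sequence and
moving the times makes it possible to cut a walk into pieces without reindexing.
\<close>

definition walk_weight :: "maxplus ^ 'n ^ 'n \<Rightarrow> (nat \<Rightarrow> 'n) \<Rightarrow> nat \<Rightarrow> nat \<Rightarrow> maxplus" where
  "walk_weight A f a b = (\<Prod>k = a..<b. A $ f k $ f (Suc k))"

lemma walk_weight_le_mat_pow:
  "a \<le> b \<Longrightarrow> walk_weight A f a b \<le> mat_pow A (b - a) $ f a $ f b"
proof (induction b)
  case 0
  then show ?case by (simp add: walk_weight_def mat_def)
next
  case (Suc b)
  show ?case
  proof (cases "a = Suc b")
    case True
    then show ?thesis by (simp add: walk_weight_def mat_def)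
  next
    case False
    with Suc.prems have le: "a \<le> b" by simp
    have "walk_weight A f a (Suc b) = walk_weight A f a b * A $ f b $ f (Suc b)"
      using le by (simp add: walk_weight_def)
    also have "\<dots> \<le> mat_pow A (b - a) $ f a $ f b * A $ f b $ f (Suc b)"
      by (intro maxplus_mult_mono Suc.IH le order_refl)
    also have "\<dots> \<le> (mat_pow A (b - a) ** A) $ f a $ f (Suc b)"
      by (rule matrix_entry_le_matrix_matrix)
    finally show ?thesis using le by (simp add: Suc_diff_le)
  qed
qed

text \<open>
A max-plus sum is attained at one of its terms, so an entry of a power is the weight of a single
optimal walk.  A zero entry has to be excluded: \<open>mat 1\<close> has zeros off the diagonal, where
there is no walk of length \<open>0\<close> at all.
\<close>

lemma mat_pow_eq_walk_weight:
  assumes "mat_pow A m $ i $ j \<noteq> 0"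
  obtains f where "f 0 = i" "f m = j" "mat_pow A m $ i $ j = walk_weight A f 0 m"
proof -
  have "mat_pow A m $ i $ j \<noteq> 0 \<Longrightarrow>
      \<exists>f. f 0 = i \<and> f m = j \<and> mat_pow A m $ i $ j = walk_weight A f 0 m"
  proof (induction m arbitrary: j)
    case 0
    then have "i = j" by (simp add: mat_def split: if_splits)
    then show ?case
      by (intro exI[of _ "\<lambda>_. i"]) (simp add: mat_def walk_weight_def)
  next
    case (Suc m)
    have sum: "mat_pow A (Suc m) $ i $ j = (\<Sum>k\<in>UNIV. mat_pow A m $ i $ k * A $ k $ j)"
      by (simp add: matrix_matrix_mult_def)
    with Suc.prems obtain k
      where k: "mat_pow A (Suc m) $ i $ j = mat_pow A m $ i $ k * A $ k $ j"
      using maxplus_sum_attained[of UNIV "\<lambda>k. mat_pow A m $ i $ k * A $ k $ j"] by auto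
    with Suc.prems have "mat_pow A m $ i $ k \<noteq> 0" by auto
    then obtain f where f: "f 0 = i" "f m = k" "mat_pow A m $ i $ k = walk_weight A f 0 m"
      using Suc.IH by blast
    let ?f = "f(Suc m := j)"
    have "walk_weight A ?f 0 (Suc m) = walk_weight A f 0 m * A $ k $ j"
      using f(2) by (simp add: walk_weight_def)
    then show ?case
      using f k by (intro exI[of _ ?f]) (simp del: fun_upd_apply, simp)
  qed
  with assms that show thesis by blast
qed

lemma asterate_nth:
  fixes A :: "maxplus ^ 'n ^ 'n"
  assumes "Tr A \<le> 1"
  shows "asterate A $ i $ j = (\<Sum>m<CARD('n). mat_pow A m $ i $ j)"
proof -
  obtain k where "CARD('n) = Suc k"
    using zero_less_card_finite[where 'a = 'n] gr0_conv_Suc by blast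
  then have "{0..CARD('n) - 1} = {..<CARD('n)}" by auto
  then show ?thesis using assms by (simp add: asterate_def)
qed

text \<open>
An optimal walk with \<open>CARD('n)\<close> steps visits \<open>CARD('n) + 1\<close> vertices, so it repeats
one.  The closed part between the two visits weighs at most \<open>Tr A \<le> 1\<close>; removing it does
not decrease the weight and leaves a walk counted by a lower power.
\<close>

lemma mat_pow_card_le_asterate:
  fixes A :: "maxplus ^ 'n ^ 'n"
  assumes Tr: "Tr A \<le> 1"
  shows "mat_pow A CARD('n) $ i $ j \<le> asterate A $ i $ j"
proof (cases "mat_pow A CARD('n) $ i $ j = 0")
  case False
  let ?n = "CARD('n)"
  obtain f where f: "f 0 = i" "f ?n = j" "mat_pow A ?n $ i $ j = walk_weight A f 0 ?n"
    using mat_pow_eq_walk_weight[OF False] by blast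
  have "\<not> inj_on f {0..?n}"
  proof
    assume "inj_on f {0..?n}"
    then have "card {0..?n} \<le> ?n"
      by (intro card_inj_on_le[of f _ UNIV]) auto
    then show False by simp
  qed
  then obtain p q where pq: "p < q" "q \<le> ?n" "f p = f q"
    by (auto simp: inj_on_def) (metis nat_neq_iff)
  have "mat_pow A (q - p) $ f p $ f p \<le> trace (mat_pow A (q - p))"
    unfolding trace_def by (rule maxplus_member_le_sum) auto
  also have "\<dots> \<le> Tr A"
    unfolding Tr_def using pq by (intro maxplus_member_le_sum) auto
  finally have "mat_pow A (q - p) $ f p $ f p \<le> 1" using Tr by (rule order_trans)
  then have cycle: "walk_weight A f p q \<le> 1"
    using walk_weight_le_mat_pow[of p q A f] pq by auto
  \<comment> \<open>The two remaining pieces meet at \<open>f p = f q\<close>, so their matrix powers compose.\<close>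
  have "walk_weight A f 0 ?n = walk_weight A f 0 p * walk_weight A f p q * walk_weight A f q ?n"
    using pq unfolding walk_weight_def by (simp add: prod.atLeastLessThan_concat)
  also have "\<dots> \<le> mat_pow A p $ i $ f p * 1 * mat_pow A (?n - q) $ f p $ j"
    using walk_weight_le_mat_pow[of 0 p A f] walk_weight_le_mat_pow[of q ?n A f] cycle pq f
    by (intro maxplus_mult_mono) simp_all
  also have "\<dots> \<le> mat_pow A (p + (?n - q)) $ i $ j"
    by (simp add: mat_pow_add matrix_entry_le_matrix_matrix)
  also have "\<dots> \<le> asterate A $ i $ j"
    unfolding asterate_nth[OF Tr] using pq by (intro maxplus_member_le_sum) auto
  finally show ?thesis using f by simp
qed simp

lemma mat_pow_le_asterate:
  fixes A :: "maxplus ^ 'n ^ 'n"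
  assumes "Tr A \<le> 1" "m \<le> CARD('n)"
  shows "mat_pow A m $ i $ j \<le> asterate A $ i $ j"
proof (cases "m = CARD('n)")
  case False
  with assms(2) have "m \<in> {..<CARD('n)}" by simp
  then show ?thesis
    unfolding asterate_nth[OF assms(1)] by (intro maxplus_member_le_sum) auto
qed (simp add: mat_pow_card_le_asterate assms(1))

lemma asterate_vector_le_iff:
  fixes A :: "maxplus ^ 'n ^ 'n"
  assumes "Tr A \<le> 1"
  shows "asterate A *v u \<le> y \<longleftrightarrow> (\<forall>m<CARD('n). mat_pow A m *v u \<le> y)"
  by (auto simp: matrix_vector_le_iff asterate_nth[OF assms] sum_distrib_right maxplus_sum_le_iff)

lemma le_asterate:
  fixes A :: "maxplus ^ 'n ^ 'n"
  assumes "Tr A \<le> 1"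
  shows "u \<le> asterate A *v u"
proof -
  have "mat_pow A 0 *v u \<le> asterate A *v u"
    using asterate_vector_le_iff[OF assms, of u "asterate A *v u"]
      zero_less_card_finite[where 'a = 'n] by blast
  then show ?thesis by simp
qed

lemma asterate_le_subfixed:
  assumes "Tr A \<le> 1" "A *v x \<le> x"
  shows "asterate A *v x \<le> x"
  using assms by (simp add: asterate_vector_le_iff mat_pow_subfixed)

text \<open>
Left multiplication by \<open>A\<close> shifts the exponents \<open>0, \<dots>, n - 1\<close> of the asterate to
\<open>1, \<dots>, n\<close>; only the top one is new, and the asterate dominates it as well.
\<close>

lemma asterate_subfixed:
  fixes A :: "maxplus ^ 'n ^ 'n"
  assumes "Tr A \<le> 1"
  shows "A *v (asterate A *v u) \<le> asterate A *v u"
proof -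
  have step: "A ** mat_pow A m = mat_pow A (Suc m)" for m
    using mat_pow_add[of A 1 m] by simp
  have "(A ** asterate A) $ i $ j \<le> asterate A $ i $ j" for i j
  proof -
    have "A $ i $ k * mat_pow A m $ k $ j \<le> asterate A $ i $ j" if "m < CARD('n)" for k m
    proof -
      have "A $ i $ k * mat_pow A m $ k $ j \<le> mat_pow A (Suc m) $ i $ j"
        by (metis step matrix_entry_le_matrix_matrix)
      also have "\<dots> \<le> asterate A $ i $ j"
        using that by (intro mat_pow_le_asterate assms) simp
      finally show ?thesis .
    qed
    then show ?thesis
      unfolding matrix_matrix_mult_def
      by (auto simp: asterate_nth[OF assms] sum_distrib_left maxplus_sum_le_iff)
  qed
  then have "A ** asterate A \<le> asterate A" by (simp add: less_eq_vec_def)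
  then show ?thesis
    unfolding matrix_vector_mul_assoc by (intro matrix_vector_mono order_refl)
qed

text \<open>
A solution \<open>x\<close> of the system is its own parameter \<open>u\<close>: the asterate fixes every
subfixed vector.
\<close>

lemma subfixed_above_iff_asterate:
  assumes "Tr A \<le> 1"
  shows "A *v x \<le> x \<and> g \<le> x \<longleftrightarrow> (\<exists>u. g \<le> u \<and> x = asterate A *v u)"
proof
  assume x: "A *v x \<le> x \<and> g \<le> x"
  then have "x = asterate A *v x"
    using asterate_le_subfixed[OF assms] le_asterate[OF assms] by (blast intro: antisym)
  with x show "\<exists>u. g \<le> u \<and> x = asterate A *v u" by blast
next
  assume "\<exists>u. g \<le> u \<and> x = asterate A *v u"
  then show "A *v x \<le> x \<and> g \<le> x"
    using asterate_subfixed[OF assms] le_asterate[OF assms] by (blast intro: order_trans)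
qed

section \<open>The optimization problem\<close>

definition vec_max :: "maxplus ^ 'n \<Rightarrow> maxplus" where
  "vec_max x = (\<Sum>i\<in>UNIV. x $ i)"

lemma vec_max_mono: "x \<le> y \<Longrightarrow> vec_max x \<le> vec_max y"
  by (simp add: vec_max_def less_eq_vec_def sum_mono)

lemma vec_max_scale: "vec_max (c *s x) = c * vec_max x"
  by (simp add: vec_max_def sum_distrib_left)

lemma matrix_vector_scale:
  fixes A :: "maxplus ^ 'n ^ 'm"
  shows "A *v (c *s x) = c *s (A *v x)"
  by (simp add: vec_eq_iff matrix_vector_mult_def sum_distrib_left mult.left_commute)

lemma ones_row_mult_nth: "(ones_row ** M) $ 1 $ j = (\<Sum>i\<in>UNIV. M $ i $ j)"
  by (simp add: matrix_matrix_mult_def rowvector_def)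

lemma ones_col_ones_row_mult_vector_nth:
  fixes C :: "maxplus ^ 'n ^ 'n"
  shows "((ones_col :: maxplus ^ 1 ^ 'n) ** (ones_row :: maxplus ^ 'n ^ 1) ** C) *v x = (\<chi> i. vec_max (C *v x))"
proof -
  have "((ones_col :: maxplus ^ 1 ^ 'n) ** (ones_row :: maxplus ^ 'n ^ 1) ** C) $ i $ j =
      (\<Sum>k\<in>UNIV. C $ k $ j)" for i j
    by (simp add: matrix_matrix_mult_def columnvector_def rowvector_def)
  then show ?thesis
    unfolding vec_max_def matrix_vector_mult_def
    by (simp add: vec_eq_iff sum_distrib_right) (intro allI sum.swap)
qed

lemma ones_row_mult_ones_col:
  "(ones_row ** M ** ones_col) $ 1 $ 1 = vec_max (M *v 1)"
proof -
  have "(ones_row ** M ** ones_col) $ 1 $ 1 = (\<Sum>j\<in>UNIV. \<Sum>i\<in>UNIV. M $ i $ j)"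
    by (simp add: matrix_matrix_mult_def rowvector_def columnvector_def)
  also have "\<dots> = vec_max (M *v 1)"
    unfolding vec_max_def matrix_vector_mult_def by (simp, rule sum.swap)
  finally show ?thesis .
qed

lemma mat_norm_eq_vec_max: "mat_norm M = vec_max (M *v 1)"
  by (simp add: mat_norm_def vec_max_def matrix_vector_mult_def)

lemma objective_eq:
  fixes C :: "maxplus ^ 'n ^ 'n"
  shows "objective C x = vec_max (C *v x) * (\<Sum>k\<in>UNIV. inverse (x $ k))"
proof -
  have "(ones_row ** C ** (columnvector x :: maxplus ^ 1 ^ 'n)) $ 1 $ 1 = vec_max (C *v x)"
    unfolding matrix_mul_assoc[symmetric] ones_row_mult_nth
    by (simp add: matrix_matrix_mult_def columnvector_def vec_max_def matrix_vector_mult_def)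
  moreover have "(M ** conj_row x ** ones_col) $ 1 $ 1 = M $ 1 $ 1 * (\<Sum>k\<in>UNIV. inverse (x $ k))"
    for M :: "maxplus ^ 1 ^ 1"
    by (simp add: matrix_matrix_mult_def columnvector_def conj_row_def rowvector_def sum_distrib_left)
  ultimately show ?thesis unfolding objective_def by simp
qed

lemma feasible_iff:
  "feasible C D g x \<longleftrightarrow> regular x \<and> (D ** C) *v x \<le> x \<and> g \<le> x"
  by (simp add: feasible_def vec_add_le_iff)

text \<open>
The maximum of the inverses of the entries of \<open>x\<close> enters the objective, so the bound splits
into one inequality per entry, and the nonzero entry and the nonzero bound can be moved across each
of them.
\<close>

lemma objective_le_iff:
  fixes C :: "maxplus ^ 'n ^ 'n"
  assumes "regular x" "t \<noteq> 0"
  shows "objective C x \<le> t \<longleftrightarrow>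
    scale_mat (inverse t) (ones_col ** (ones_row :: maxplus ^ 'n ^ 1) ** C) *v x \<le> x"
proof -
  have "scale_mat c M *v x = c *s (M *v x)" for c and M :: "maxplus ^ 'n ^ 'n"
    by (simp add: vec_eq_iff scale_mat_def matrix_vector_mult_def sum_distrib_left mult.assoc)
  then have "scale_mat (inverse t) (ones_col ** (ones_row :: maxplus ^ 'n ^ 1) ** C) *v x \<le> x
      \<longleftrightarrow> (\<forall>i. inverse t * vec_max (C *v x) \<le> x $ i)"
    by (simp add: ones_col_ones_row_mult_vector_nth less_eq_vec_def)
  also have "\<dots> \<longleftrightarrow> (\<forall>i. vec_max (C *v x) * inverse (x $ i) \<le> t)"
    using assms
    by (simp add: regular_def maxplus_inverse_mult_le_iff maxplus_mult_inverse_le_iff)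
  also have "\<dots> \<longleftrightarrow> objective C x \<le> t"
    by (simp add: objective_eq sum_distrib_left maxplus_sum_le_iff)
  finally show ?thesis by simp
qed

text \<open>
A subfixed \<open>x\<close> dominates its least entry times \<open>asterate A *v 1\<close>, and the other
factor of the objective cancels exactly that entry.
\<close>

lemma objective_lower_bound:
  fixes C A :: "maxplus ^ 'n ^ 'n"
  assumes "regular x" "Tr A \<le> 1" "A *v x \<le> x"
  shows "vec_max (C *v (asterate A *v 1)) \<le> objective C x"
proof -
  let ?\<mu> = "\<Sum>k\<in>UNIV. inverse (x $ k)"
  have "x $ i \<noteq> 0" for i using assms(1) by (simp add: regular_def)
  moreover have "inverse a \<noteq> 0" if "a \<noteq> 0" for a :: maxplus
    using that by (cases a) (auto simp: zero_maxplus_def)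
  ultimately have inv: "inverse (x $ i) \<noteq> 0" for i
    by blast
  have le: "inverse (x $ i) \<le> ?\<mu>" for i
    by (rule maxplus_member_le_sum) auto
  then have \<mu>: "?\<mu> \<noteq> 0" using inv by (metis maxplus_le_zero_iff)
  \<comment> \<open>\<open>inverse ?\<mu>\<close> is the least entry of \<open>x\<close>.\<close>
  have "inverse ?\<mu> * 1 \<le> x $ i" for i
    using le[of i] \<mu> \<open>\<And>i. x $ i \<noteq> 0\<close>
    by (metis maxplus_inverse_mult_le_iff maxplus_mult_inverse_le_iff mult_1)
  then have "inverse ?\<mu> *s 1 \<le> x"
    by (simp add: less_eq_vec_def)
  then have "inverse ?\<mu> *s (asterate A *v 1) \<le> x"
    using asterate_le_subfixed[OF assms(2,3)]
      matrix_vector_mono[of "asterate A" "asterate A" "inverse ?\<mu> *s 1" x]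
    by (simp add: matrix_vector_scale)
  then have "inverse ?\<mu> * vec_max (C *v (asterate A *v 1)) \<le> vec_max (C *v x)"
    by (metis vec_max_mono matrix_vector_mono order_refl vec_max_scale matrix_vector_scale)
  then show ?thesis
    using \<mu> by (simp add: maxplus_inverse_mult_le_iff objective_eq mult.commute[of _ ?\<mu>])
qed

lemma vec_max_column_regular_nonzero:
  fixes C :: "maxplus ^ 'n ^ 'n"
  assumes "column_regular C" "regular y"
  shows "vec_max (C *v y) \<noteq> 0"
proof -
  fix j :: 'n
  obtain i where "C $ i $ j \<noteq> 0" using assms(1) by (auto simp: column_regular_def)
  then have "C $ i $ j * y $ j \<noteq> 0" using assms(2) by (simp add: regular_def)
  moreover have "C $ i $ j * y $ j \<le> (C *v y) $ i"
    using matrix_vector_le_iff[of C y "C *v y"] by simp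
  moreover have "(C *v y) $ i \<le> vec_max (C *v y)"
    unfolding vec_max_def by (rule maxplus_member_le_sum) auto
  ultimately show ?thesis by (metis maxplus_le_zero_iff order_trans)
qed

theorem theorem12:
  fixes C D :: "maxplus ^ 'n ^ 'n" and g :: "maxplus ^ 'n"
  assumes "column_regular C"
    and "Tr (D ** C) \<le> 1"
  shows "let \<theta> = (ones_row ** C ** asterate (D ** C) ** ones_col) $ 1 $ 1 in
      ((\<exists>x. feasible C D g x \<and> objective C x = \<theta>) \<and>
       (\<forall>x. feasible C D g x \<longrightarrow> \<theta> \<le> objective C x)) \<and>
      \<theta> = mat_norm (C ** asterate (D ** C)) \<and>
      (\<forall>x. regular x \<longrightarrow>
        (is_arg_min (objective C) (feasible C D g) x \<longleftrightarrow>
         (\<exists>u. g \<le> u \<and>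
           x = asterate (scale_mat (inverse \<theta>) (ones_col ** (ones_row :: maxplus ^ 'n ^ 1) ** C) + D ** C) *v u)))"
proof -
  define B where "B = D ** C"
  define y where "y = asterate B *v 1"
  define \<theta> where "\<theta> = vec_max (C *v y)"
  define A where
    "A = scale_mat (inverse \<theta>) (ones_col ** (ones_row :: maxplus ^ 'n ^ 1) ** C) + B"
  have Tr: "Tr B \<le> 1" using assms(2) by (simp add: B_def)
  have theta: "(ones_row ** C ** asterate B ** ones_col) $ 1 $ 1 = \<theta>"
    unfolding \<theta>_def y_def using ones_row_mult_ones_col[of "C ** asterate B"]
    by (simp add: matrix_mul_assoc matrix_vector_mul_assoc)
  have norm: "\<theta> = mat_norm (C ** asterate B)"
    unfolding \<theta>_def y_def by (simp add: mat_norm_eq_vec_max matrix_vector_mul_assoc)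
  have y_ge: "1 \<le> y" unfolding y_def by (rule le_asterate[OF Tr])
  have "y $ i \<noteq> 0" for i
    using y_ge by (auto simp: less_eq_vec_def dest!: spec[of _ i])
  then have y_reg: "regular y" by (simp add: regular_def)
  have \<theta>0: "\<theta> \<noteq> 0" unfolding \<theta>_def by (rule vec_max_column_regular_nonzero[OF assms(1) y_reg])

  have lower: "\<theta> \<le> objective C x" if "feasible C D g x" for x
    using that objective_lower_bound[OF _ Tr] unfolding \<theta>_def y_def feasible_iff B_def by blast

  have optimal_iff: "feasible C D g x \<and> objective C x \<le> \<theta> \<longleftrightarrow> A *v x \<le> x \<and> g \<le> x"
    if "regular x" for x
    using that objective_le_iff[OF that \<theta>0, of C]
    by (auto simp: feasible_iff A_def B_def matrix_vector_mult_add_rdistrib vec_add_le_iff)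

  have By: "B *v y \<le> y" unfolding y_def by (rule asterate_subfixed[OF Tr])
  have "objective C y \<le> \<theta>"
  proof -
    have "\<theta> * 1 \<le> \<theta> * y $ i" for i
      using y_ge by (intro maxplus_mult_mono) (simp_all add: less_eq_vec_def)
    then have "\<theta> * inverse (y $ i) \<le> \<theta>" for i
      using y_reg by (simp add: regular_def maxplus_mult_inverse_le_iff)
    then show ?thesis
      by (simp add: objective_eq \<theta>_def[symmetric] sum_distrib_left maxplus_sum_le_iff)
  qed
  then have Ay: "A *v y \<le> y"
    using By objective_le_iff[OF y_reg \<theta>0, of C]
    by (simp add: A_def matrix_vector_mult_add_rdistrib vec_add_le_iff)
  have TrA: "Tr A \<le> 1" by (rule Tr_le_one_if_subfixed[OF y_reg Ay])

  \<comment> \<open>Scaling keeps \<open>y\<close> subfixed.  The summand \<open>1\<close> keeps \<open>c\<close> invertible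
    in case all entries of \<open>g\<close> are zero.\<close>
  define c where "c = 1 + vec_max g"
  have c0: "c \<noteq> 0" by (auto simp: c_def plus_maxplus_def max_def)
  have x_reg: "regular (c *s y)" using y_reg c0 by (simp add: regular_def)
  have "A *v (c *s y) \<le> c *s y"
    using Ay by (simp add: matrix_vector_scale less_eq_vec_def maxplus_mult_mono)
  moreover have "g \<le> c *s y"
  proof -
    have "g $ i * 1 \<le> c * y $ i" for i
    proof (intro maxplus_mult_mono)
      have "g $ i \<le> vec_max g" unfolding vec_max_def by (rule maxplus_member_le_sum) auto
      then show "g $ i \<le> c" by (simp add: c_def plus_maxplus_def le_max_iff_disj)
      show "1 \<le> y $ i" using y_ge by (simp add: less_eq_vec_def)
    qed
    then show ?thesis by (simp add: less_eq_vec_def)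
  qed
  ultimately have x: "feasible C D g (c *s y)" "objective C (c *s y) = \<theta>"
    using optimal_iff[OF x_reg] lower by (auto intro: antisym)

  have "is_arg_min (objective C) (feasible C D g) x \<longleftrightarrow> (\<exists>u. g \<le> u \<and> x = asterate A *v u)"
    if "regular x" for x
  proof -
    have "is_arg_min (objective C) (feasible C D g) x \<longleftrightarrow>
        feasible C D g x \<and> objective C x \<le> \<theta>"
      using x lower unfolding is_arg_min_def by (metis leD leI order_trans)
    also have "\<dots> \<longleftrightarrow> (\<exists>u. g \<le> u \<and> x = asterate A *v u)"
      using optimal_iff[OF that] subfixed_above_iff_asterate[OF TrA] by simp
    finally show ?thesis .
  qed
  then show ?thesis
    unfolding Let_def B_def[symmetric] theta A_def[symmetric]
    using x lower norm by blast
qed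

end
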